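(* Let $\lambda\ge 0.7983$ and let $Y\ge 2$ be real. Suppose $T$ is a $2$-primitive set of composite numbers such that \[ \sum_{t \in T_p} \frac{1}{t^\lambda} > \frac{1}{p^\lambda} \qquad \text{for all } p \in \mathcal{P}(T), \] where $T_p=\{t\in T: p\mid t\}$, and such that $\mathcal{P}(T)$ is exactly the set of all primes in $(1,Y]$. Then \[ \sum_{t \in T} \frac{1}{t^\lambda} - \sum_{p \le Y} \frac{1}{p^\lambda} < 0. \]
   Context: A set $T$ of integers greater than $1$ with $|T|\ge 3$ is called $2$-primitive if no element of $T$ divides the product of $2$ distinct other elements of $T$. $\mathcal{P}(T)$ denotes the set of primes dividing some member of $T$; $p$ runs over primes. *)

theory Defs
  imports "HOL-Analysis.Analysis" "HOL-Computational_Algebra.Primes"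
begin

(* The first disjunct makes the cardinality condition mean "at least three elements"
   for infinite T as well, where card T = 0. *)
definition two_primitive :: "nat set \<Rightarrow> bool" where
  "two_primitive T \<longleftrightarrow>
     (\<forall>t\<in>T. 1 < t) \<and>
     (infinite T \<or> 3 \<le> card T) \<and>
     (\<forall>a\<in>T. \<forall>b\<in>T. \<forall>c\<in>T. a \<noteq> b \<longrightarrow> a \<noteq> c \<longrightarrow> b \<noteq> c \<longrightarrow> \<not> a dvd b * c)"

definition composite :: "nat \<Rightarrow> bool" where
  "composite n \<longleftrightarrow> 1 < n \<and> \<not> prime n"

definition primes_of :: "nat set \<Rightarrow> nat set" where
  "primes_of T = {p. prime p \<and> (\<exists>t\<in>T. p dvd t)}"

definition multiples_in :: "nat set \<Rightarrow> nat \<Rightarrow> nat set" where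
  "multiples_in T p = {t \<in> T. p dvd t}"

end

theory Submission
  imports Defs
begin

text \<open>
Call a divisor of \<open>t \<in> T\<close> private if it divides no other element of \<open>T\<close>. If \<open>t = u v\<close> with
\<open>u\<close>, \<open>v\<close> coprime, then 2-primitivity makes \<open>u\<close> or \<open>v\<close> private, while the hypothesis on the sums
over \<open>T\<^sub>p\<close> says that no prime is private. Hence every \<open>t\<close> has a private composite divisor
\<open>d \<le> t\<^bsup>2/3\<^esup>\<close>, except that for each prime \<open>p\<close> there may be one \<open>t\<close> dominated by a private power
\<open>p\<^bsup>a\<^esup>\<close> with \<open>a \<ge> 3\<close>; its contribution is at most \<open>p\<^bsup>-3\<lambda>\<^esup>\<close>.

Charge \<open>t\<^bsup>-\<lambda>\<^esup> \<le> d\<^bsup>-3\<lambda>/2\<^esup>\<close> to the largest prime \<open>q\<close> of \<open>d\<close>. The chosen divisors form an antichain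
under divisibility, so those charged to \<open>q\<close> are determined by the odd part of \<open>d/q\<close>, and their
total is at most \<open>q\<^bsup>-3\<lambda>/2\<^esup> (E(q) - 1/2)\<close>, where \<open>E(q)\<close> is the product of \<open>p/(p-1)\<close> over the odd
primes \<open>p \<le> q\<close>. Since \<open>E(q)\<^sup>3 \<le> 3q/2\<close> for \<open>q \<ge> 7\<close>, this plus \<open>q\<^bsup>-3\<lambda>\<^esup>\<close> is less than
\<open>q\<^bsup>-\<lambda>\<^esup>\<close> for every prime \<open>q\<close>.
\<close>

section \<open>Reciprocal sums over smooth numbers and divisibility antichains\<close>

definition odd_euler :: "nat \<Rightarrow> real" where
  "odd_euler n = (\<Prod>p | prime p \<and> odd p \<and> p \<le> n. real p / (real p - 1))"

text \<open>One half of Euler's product, by induction on \<open>P\<close>: writing u = p^k v with v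
  prime to p embeds \<open>U\<close> into a box of pairs (k, v). Over the full box the sum splits
  into a finite geometric series and a sum over numbers built from the remaining primes.\<close>

lemma sum_inverse_smooth_le:
  fixes P U :: "nat set"
  assumes "finite P" "\<forall>p\<in>P. prime p" "finite U"
    and "\<And>u. u \<in> U \<Longrightarrow> 0 < u"
    and "\<And>u p. u \<in> U \<Longrightarrow> prime p \<Longrightarrow> p dvd u \<Longrightarrow> p \<in> P"
  shows "(\<Sum>u\<in>U. 1 / real u) \<le> (\<Prod>p\<in>P. real p / (real p - 1))"
  using assms
proof (induction P arbitrary: U rule: finite_induct)
  case empty
  have "u = 1" if "u \<in> U" for u
    using empty.prems(3)[OF that] empty.prems(4)[OF that] prime_factor_nat[of u] by auto
  then have "U \<subseteq> {1}" by auto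
  then have "(\<Sum>u\<in>U. 1 / real u) \<le> (\<Sum>u\<in>{1::nat}. 1 / real u)"
    by (intro sum_mono2) auto
  then show ?case by simp
next
  case (insert p P)
  have p: "prime p" using insert.prems by auto
  have p1: "real p > 1" using prime_gt_1_nat[OF p] by simp
  let ?k = "\<lambda>u. multiplicity p u"
  let ?v = "\<lambda>u. u div p ^ ?k u"
  have dec: "u = p ^ ?k u * ?v u" for u :: nat
    by (simp add: multiplicity_dvd)
  define K where "K = Max (insert 0 (?k ` U))"
  define V where "V = ?v ` U"
  have K: "?k u \<le> K" if "u \<in> U" for u
    unfolding K_def using that insert.prems(2) by (intro Max_ge) auto
  have finV: "finite V" using insert.prems(2) by (simp add: V_def)
  have inj: "inj_on (\<lambda>u. (?k u, ?v u)) U"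
    by (rule inj_onI) (metis dec prod.inject)
  have IH: "(\<Sum>v\<in>V. 1 / real v) \<le> (\<Prod>p\<in>P. real p / (real p - 1))"
  proof (rule insert.IH)
    show "\<forall>p\<in>P. prime p" using insert.prems by auto
    show "finite V" by (rule finV)
    show "0 < v" if "v \<in> V" for v
      using that insert.prems(3) dec unfolding V_def
      by (metis (no_types, lifting) gr0I image_iff mult_0_right nat_less_le)
    show "r \<in> P" if v: "v \<in> V" and r: "prime r" "r dvd v" for v r
    proof -
      obtain u where u: "u \<in> U" "v = ?v u" using v unfolding V_def by auto
      have "r dvd u" using r(2) u(2) dec[of u] by (metis dvd_mult)
      then have "r \<in> insert p P" using insert.prems(4) u r by blast
      moreover have "r \<noteq> p"
      proof
        assume "r = p"
        moreover have "\<not> p dvd ?v u"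
          using insert.prems(3)[OF u(1)] p
          by (intro multiplicity_decompose) (auto simp: prime_nat_iff)
        ultimately show False using r u by simp
      qed
      ultimately show ?thesis by simp
    qed
  qed
  have geo: "(\<Sum>k\<le>K. (1 / real p) ^ k) \<le> real p / (real p - 1)"
  proof -
    have "(\<Sum>k\<le>K. (1 / real p) ^ k) = (\<Sum>k<Suc K. (1 / real p) ^ k)"
      by (simp add: lessThan_Suc_atMost)
    also have "\<dots> = (1 - (1 / real p) ^ Suc K) / (1 - 1 / real p)"
      using p1 by (subst sum_gp_strict) auto
    also have "\<dots> \<le> 1 / (1 - 1 / real p)"
      using p1 by (intro divide_right_mono) auto
    also have "\<dots> = real p / (real p - 1)" using p1 by (simp add: field_simps)
    finally show ?thesis .
  qed
  have "(\<Sum>u\<in>U. 1 / real u) = (\<Sum>u\<in>U. (1 / real p) ^ ?k u * (1 / real (?v u)))"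
  proof (rule sum.cong[OF refl])
    fix u
    have "real u = real p ^ ?k u * real (?v u)" by (metis dec of_nat_mult of_nat_power)
    then show "1 / real u = (1 / real p) ^ ?k u * (1 / real (?v u))"
      by (simp add: power_one_over)
  qed
  also have "\<dots> = (\<Sum>(k, v)\<in>(\<lambda>u. (?k u, ?v u)) ` U. (1 / real p) ^ k * (1 / real v))"
    by (subst sum.reindex[OF inj]) (simp add: o_def)
  also have "\<dots> \<le> (\<Sum>(k, v)\<in>{..K} \<times> V. (1 / real p) ^ k * (1 / real v))"
    using K finV by (intro sum_mono2) (auto simp: V_def)
  also have "\<dots> = (\<Sum>k\<le>K. (1 / real p) ^ k) * (\<Sum>v\<in>V. 1 / real v)"
    by (simp add: sum_product sum.cartesian_product)
  also have "\<dots> \<le> real p / (real p - 1) * (\<Prod>p\<in>P. real p / (real p - 1))"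
    using geo IH p1 by (intro mult_mono) (auto intro: sum_nonneg)
  finally show ?case using insert.hyps by simp
qed

lemma sum_powr_antichain_le:
  fixes D :: "nat set" and s :: real
  assumes "finite D" and q: "prime q" and s: "1 \<le> s"
    and comp: "\<And>d. d \<in> D \<Longrightarrow> composite d"
    and qd: "\<And>d. d \<in> D \<Longrightarrow> q dvd d"
    and smooth: "\<And>d p. d \<in> D \<Longrightarrow> prime p \<Longrightarrow> p dvd d \<Longrightarrow> p \<le> q"
    and anti: "\<And>d e. d \<in> D \<Longrightarrow> e \<in> D \<Longrightarrow> d dvd e \<Longrightarrow> d = e"
  shows "(\<Sum>d\<in>D. real d powr - s) \<le> real q powr - s * (odd_euler q - 1 / 2)"
proof -
  define m where "m d = d div q" for d
  define k where "k d = multiplicity 2 (m d)" for d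
  define u where "u d = m d div 2 ^ k d" for d
  define w where "w x = (if x = 1 then 1 / 2 else 1 / real x)" for x :: nat
  have dm: "d = q * m d" if "d \<in> D" for d using qd[OF that] by (simp add: m_def)
  have m2: "2 \<le> m d" if "d \<in> D" for d
  proof -
    have "m d \<noteq> 0" "m d \<noteq> 1"
      using dm[OF that] comp[OF that] q by (auto simp: composite_def)
    then show ?thesis by simp
  qed
  have mu: "m d = 2 ^ k d * u d" for d
    by (simp add: u_def k_def multiplicity_dvd)
  have du: "d = q * (2 ^ k d * u d)" if "d \<in> D" for d
    using dm[OF that] mu by simp
  have odd_u: "odd (u d)" if "d \<in> D" for d
    unfolding u_def k_def using m2[OF that] by (intro multiplicity_decompose) auto
  \<comment> \<open>Two elements with the same odd part are comparable under divisibility.\<close>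
  have inj: "inj_on u D"
  proof (rule inj_onI)
    fix d e assume de: "d \<in> D" "e \<in> D" "u d = u e"
    have "d dvd e \<or> e dvd d"
    proof (cases "k d \<le> k e")
      case True
      then have "q * (2 ^ k d * u d) dvd q * (2 ^ k e * u e)"
        using de(3) by (intro mult_dvd_mono le_imp_power_dvd) auto
      then show ?thesis using du[OF de(1)] du[OF de(2)] by metis
    next
      case False
      then have "q * (2 ^ k e * u e) dvd q * (2 ^ k d * u d)"
        using de(3) by (intro mult_dvd_mono le_imp_power_dvd) auto
      then show ?thesis using du[OF de(1)] du[OF de(2)] by metis
    qed
    then show "d = e" using anti de by metis
  qed
  have wm: "1 / real (m d) \<le> w (u d)" if "d \<in> D" for d
  proof (cases "u d = 1")
    case True
    then show ?thesis using m2[OF that] by (simp add: w_def field_simps)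
  next
    case False
    have "u d \<le> m d" unfolding u_def by simp
    moreover have "0 < u d" using odd_u[OF that] by (rule odd_pos)
    ultimately show ?thesis using False by (simp add: w_def frac_le)
  qed
  have bound: "real d powr - s \<le> real q powr - s * w (u d)" if "d \<in> D" for d
  proof -
    have "real d powr - s = real q powr - s * real (m d) powr - s"
      by (subst dm[OF that]) (simp add: powr_mult)
    also have "real (m d) powr - s \<le> real (m d) powr - 1"
      using m2[OF that] s by (intro powr_mono) auto
    also have "real (m d) powr - 1 = 1 / real (m d)"
      using m2[OF that] by (simp add: powr_minus_divide)
    also have "\<dots> \<le> w (u d)" by (rule wm[OF that])
    finally show ?thesis by (simp add: mult_left_mono)
  qed
  have euler: "(\<Sum>x\<in>insert 1 (u ` D). 1 / real x) \<le> odd_euler q"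
    unfolding odd_euler_def
  proof (rule sum_inverse_smooth_le)
    show "finite {p. prime p \<and> odd p \<and> p \<le> q}" by (rule finite_subset[of _ "{..q}"]) auto
    show "\<forall>p\<in>{p. prime p \<and> odd p \<and> p \<le> q}. prime p" by simp
    show "finite (insert 1 (u ` D))" using assms(1) by simp
    show "0 < x" if "x \<in> insert 1 (u ` D)" for x using that odd_u odd_pos by auto
    show "p \<in> {p. prime p \<and> odd p \<and> p \<le> q}"
      if x: "x \<in> insert 1 (u ` D)" and p: "prime p" "p dvd x" for x p
    proof -
      have "x \<noteq> 1" using p by auto
      then obtain d where d: "d \<in> D" "x = u d" using x by auto
      have "p dvd d" using du[OF d(1)] p(2) d(2) by (metis dvd_mult)
      then have "p \<le> q" using smooth d p by blast
      moreover have "odd p" using odd_u[OF d(1)] p(2) d(2) by (metis dvd_trans)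
      ultimately show ?thesis using p by simp
    qed
  qed
  have "(\<Sum>d\<in>D. real d powr - s) \<le> (\<Sum>d\<in>D. real q powr - s * w (u d))"
    by (intro sum_mono bound)
  also have "\<dots> = real q powr - s * (\<Sum>x\<in>u ` D. w x)"
    by (simp add: sum.reindex[OF inj] sum_distrib_left)
  \<comment> \<open>Including 1, whether or not it occurs as an odd part, makes the deficit against
    the reciprocal sum exactly 1/2.\<close>
  also have "(\<Sum>x\<in>u ` D. w x) \<le> (\<Sum>x\<in>insert 1 (u ` D). w x)"
    using assms(1) by (intro sum_mono2) (auto simp: w_def)
  also have "\<dots> = (\<Sum>x\<in>insert 1 (u ` D). 1 / real x) - 1 / 2"
  proof -
    have "(\<Sum>x\<in>u ` D - {1}. w x) = (\<Sum>x\<in>u ` D - {1}. 1 / real x)"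
      by (intro sum.cong) (auto simp: w_def)
    then show ?thesis using assms(1) by (simp add: sum.insert_remove w_def)
  qed
  also have "\<dots> \<le> odd_euler q - 1 / 2" using euler by simp
  finally show ?thesis by (simp add: mult_left_mono)
qed

section \<open>Growth of the product over odd primes\<close>

lemma odd_euler_nonneg: "0 \<le> odd_euler n"
  unfolding odd_euler_def by (intro prod_nonneg) (auto dest: prime_gt_1_nat)

text \<open>Each factor p/(p-1) with p > 1 is at least 1, so \<open>N\<close> may contain composite
  numbers. This permits replacing the primes of an interval by the residue classes coprime to
  6.\<close>

lemma odd_euler_extend:
  assumes "m \<le> n" "finite N"
    and "\<And>p. prime p \<Longrightarrow> odd p \<Longrightarrow> m < p \<Longrightarrow> p \<le> n \<Longrightarrow> p \<in> N"
    and "\<And>p. p \<in> N \<Longrightarrow> 1 < p"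
  shows "odd_euler n \<le> odd_euler m * (\<Prod>p\<in>N. real p / (real p - 1))"
proof -
  let ?Q = "{p. prime p \<and> odd p \<and> m < p \<and> p \<le> n}"
  let ?P = "{p. prime p \<and> odd p \<and> p \<le> m}"
  have fin: "finite ?P" "finite ?Q"
    using finite_subset[of ?P "{..m}"] finite_subset[of ?Q "{..n}"] by auto
  have "{p. prime p \<and> odd p \<and> p \<le> n} = ?P \<union> ?Q" using assms(1) by auto
  then have "odd_euler n = (\<Prod>p\<in>?P \<union> ?Q. real p / (real p - 1))"
    by (simp only: odd_euler_def)
  also have "\<dots> = odd_euler m * (\<Prod>p\<in>?Q. real p / (real p - 1))"
    unfolding odd_euler_def by (rule prod.union_disjoint) (use fin in auto)
  also have "(\<Prod>p\<in>?Q. real p / (real p - 1)) \<le> (\<Prod>p\<in>N. real p / (real p - 1))"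
  proof (rule prod_mono2)
    show "finite N" by (rule assms)
    show "?Q \<subseteq> N" using assms(3) by auto
    show "1 \<le> real p / (real p - 1)" if "p \<in> N - ?Q" for p
      using assms(4)[of p] that by (simp add: field_simps)
    show "0 \<le> real p / (real p - 1)" if "p \<in> ?Q" for p
      using that by (auto dest: prime_gt_1_nat)
  qed
  finally show ?thesis using odd_euler_nonneg by (simp add: mult_left_mono)
qed

lemma prime_mod_6:
  assumes "prime (p::nat)" "3 < p"
  obtains j where "p = 6 * j + 1 \<or> p = 6 * j + 5"
proof -
  have "\<not> 2 dvd p" "\<not> 3 dvd p"
    using assms by (auto simp: prime_nat_iff)
  then have "p mod 6 = 1 \<or> p mod 6 = 5" by presburger
  then have "p = 6 * (p div 6) + 1 \<or> p = 6 * (p div 6) + 5"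
    by (metis mult_div_mod_eq)
  then show ?thesis by (rule that)
qed

lemma odd_euler_2: "odd_euler 2 = 1"
proof -
  have "{p. prime p \<and> odd p \<and> p \<le> (2::nat)} = {}"
    using prime_ge_2_nat by (auto dest!: le_antisym)
  then show ?thesis by (simp only: odd_euler_def prod.empty)
qed

lemma odd_euler_3: "odd_euler 3 \<le> 3 / 2"
  using odd_euler_extend[of 2 3 "{3}"] odd_euler_2 by auto

lemma odd_euler_5: "odd_euler 5 \<le> 15 / 8"
proof -
  have "odd_euler 5 \<le> odd_euler 3 * (\<Prod>p\<in>{5::nat}. real p / (real p - 1))"
    by (rule odd_euler_extend) (auto, presburger)
  then show ?thesis using odd_euler_3 by simp
qed

lemma odd_euler_7: "odd_euler 7 \<le> 35 / 16"
proof -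
  have "odd_euler 7 \<le> odd_euler 5 * (\<Prod>p\<in>{7::nat}. real p / (real p - 1))"
    by (rule odd_euler_extend) (auto, presburger)
  then show ?thesis using odd_euler_5 by simp
qed

text \<open>
Bounding the product over primes by the one over all integers coprime to 6 gives growth of order
exactly \<open>n\<^bsup>1/3\<^esup>\<close>; the induction closes because the lower-order terms have the right sign.
\<close>

lemma odd_euler_cube_mod6_1: "odd_euler (6 * k + 7) ^ 3 \<le> 3 / 2 * real (6 * k + 7)"
proof (induction k)
  case 0
  have "odd_euler 7 ^ 3 \<le> (35 / 16) ^ 3"
    using odd_euler_7 odd_euler_nonneg by (intro power_mono)
  then show ?case by (simp add: power_divide)
next
  case (Suc k)
  \<comment> \<open>The numbers coprime to 6 in the new interval are \<open>N\<close> and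
    \<open>N + 2\<close>; the bound before the step is 3/2 (N - 4), after it 3/2 (N + 2).\<close>
  define N where "N = real (6 * k) + 11"
  have N: "N \<ge> 11" by (simp add: N_def)
  have "odd_euler (6 * k + 13)
      \<le> odd_euler (6 * k + 7) * (\<Prod>p\<in>{6 * k + 11, 6 * k + 13}. real p / (real p - 1))"
  proof (rule odd_euler_extend)
    show "p \<in> {6 * k + 11, 6 * k + 13}"
      if p: "prime p" "odd p" "6 * k + 7 < p" "p \<le> 6 * k + 13" for p
    proof -
      obtain j where j: "p = 6 * j + 1 \<or> p = 6 * j + 5" using prime_mod_6[OF p(1)] p(3) by auto
      have "j \<le> k \<or> j = k + 1 \<or> k + 2 \<le> j" by linarith
      then show ?thesis using j p(3,4) by auto
    qed
  qed auto
  also have "\<dots> = odd_euler (6 * k + 7) * (N * (N + 2) / ((N - 1) * (N + 1)))"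
    by (simp add: N_def algebra_simps)
  finally have "odd_euler (6 * k + 13) ^ 3
      \<le> (odd_euler (6 * k + 7) * (N * (N + 2) / ((N - 1) * (N + 1)))) ^ 3"
    using odd_euler_nonneg by (intro power_mono)
  also have "\<dots> = odd_euler (6 * k + 7) ^ 3 * (N * (N + 2) / ((N - 1) * (N + 1))) ^ 3"
    by (rule power_mult_distrib)
  also have "\<dots> \<le> 3 / 2 * (N - 4) * (N * (N + 2) / ((N - 1) * (N + 1))) ^ 3"
    using Suc.IH N by (intro mult_right_mono) (auto simp: N_def)
  also have "\<dots> \<le> 3 / 2 * (N + 2)"
  proof -
    have "(N - 4) * (N * (N + 2)) ^ 3 \<le> (N + 2) * ((N - 1) * (N + 1)) ^ 3"
    proof -
      have "(N + 2) * ((N - 1) * (N + 1)) ^ 3 - (N - 4) * (N * (N + 2)) ^ 3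
          = (N + 2) * (9 * N ^ 4 + 16 * N ^ 3 + 3 * N ^ 2 - 1)" by algebra
      moreover have "3 * N ^ 2 \<ge> 1" using N one_le_power[of N 2] by linarith
      then have "(N + 2) * (9 * N ^ 4 + 16 * N ^ 3 + 3 * N ^ 2 - 1) \<ge> 0"
        using N zero_le_power[of N 4] zero_le_power[of N 3] by (intro mult_nonneg_nonneg) linarith+
      ultimately show ?thesis by simp
    qed
    moreover have "((N - 1) * (N + 1)) ^ 3 > 0" using N by simp
    ultimately have "(N - 4) * (N * (N + 2)) ^ 3 / ((N - 1) * (N + 1)) ^ 3 \<le> N + 2"
      by (simp only: pos_divide_le_eq)
    then have "3 / 2 * ((N - 4) * (N * (N + 2)) ^ 3 / ((N - 1) * (N + 1)) ^ 3) \<le> 3 / 2 * (N + 2)"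
      by (intro mult_left_mono) auto
    then show ?thesis by (simp only: power_divide times_divide_eq_right mult.assoc)
  qed
  finally show ?case by (simp add: N_def add_ac)
qed

text \<open>For q = 6k + 11 one extra factor beyond 6k + 7 suffices: the only number coprime to 6
  after 6k + 7 and up to q is q itself.\<close>

lemma odd_euler_cube:
  assumes "prime q" "7 \<le> q"
  shows "odd_euler q ^ 3 \<le> 3 / 2 * real q"
proof -
  obtain j where j: "q = 6 * j + 1 \<or> q = 6 * j + 5"
    using prime_mod_6[OF assms(1)] assms(2) by auto
  then obtain k where "j = Suc k" using assms(2) by (cases j) auto
  then have "q = 6 * k + 7 \<or> q = 6 * k + 11" using j by auto
  then show ?thesis
  proof
    assume "q = 6 * k + 7"
    then show ?thesis using odd_euler_cube_mod6_1 by blast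
  next
    assume q: "q = 6 * k + 11"
    define N where "N = real q"
    have N: "N \<ge> 11" by (simp add: N_def q)
    have "odd_euler q \<le> odd_euler (6 * k + 7) * (\<Prod>p\<in>{q}. real p / (real p - 1))"
    proof (rule odd_euler_extend)
      show "p \<in> {q}" if p: "prime p" "odd p" "6 * k + 7 < p" "p \<le> q" for p
      proof -
        obtain j where j: "p = 6 * j + 1 \<or> p = 6 * j + 5" using prime_mod_6[OF p(1)] p(3) by auto
        have "j \<le> k \<or> j = k + 1 \<or> k + 2 \<le> j" by linarith
        then show ?thesis using j p(3,4) q by auto
      qed
    qed (auto simp: q)
    then have "odd_euler q ^ 3 \<le> (odd_euler (6 * k + 7) * (N / (N - 1))) ^ 3"
      using odd_euler_nonneg by (intro power_mono) (simp_all add: N_def)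
    also have "\<dots> = odd_euler (6 * k + 7) ^ 3 * (N / (N - 1)) ^ 3"
      by (rule power_mult_distrib)
    also have "\<dots> \<le> 3 / 2 * (N - 4) * (N / (N - 1)) ^ 3"
      using odd_euler_cube_mod6_1[of k] N by (intro mult_right_mono) (auto simp: N_def q)
    also have "\<dots> \<le> 3 / 2 * N"
    proof -
      have "N * (N - 1) ^ 3 - (N - 4) * N ^ 3 = N * (N * (N + 3) - 1)" by algebra
      moreover have "N * (N + 3) \<ge> 11 * 1" using N by (intro mult_mono) auto
      ultimately have "(N - 4) * N ^ 3 \<le> N * (N - 1) ^ 3" using N by (smt (verit) mult_nonneg_nonneg)
      moreover have "(N - 1) ^ 3 > 0" using N by simp
      ultimately have "(N - 4) * N ^ 3 / (N - 1) ^ 3 \<le> N" by (simp only: pos_divide_le_eq)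
      then show ?thesis unfolding power_divide times_divide_eq_right by linarith
    qed
    finally show ?thesis by (simp add: N_def)
  qed
qed

text \<open>Since lam/2 is at least 1/3, estimates at small primes reduce to comparing rational
  cubes.\<close>

lemma less_powr_third:
  assumes "0 \<le> c" "c ^ 3 < x" "(1::real) \<le> x" "2 / 3 \<le> lam"
  shows "c < x powr (lam / 2)"
proof -
  have "c ^ 3 < (x powr (1 / 3)) ^ 3"
    using assms by (simp add: powr_power)
  then have "c < x powr (1 / 3)" by (rule power_less_imp_less_base) simp
  also have "\<dots> \<le> x powr (lam / 2)" using assms by (intro powr_mono) auto
  finally show ?thesis .
qed

text \<open>Multiplied by q^(-3 lam/2), this says that the total charge to q stays below q^(-lam).
  Primes up to 7 use explicit bounds; from 11 on, \<open>odd_euler q\<close> alone is at most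
  q^(lam/2), and the 1/2 outweighs the last term.\<close>

lemma odd_euler_less_powr:
  assumes q: "prime q" and lam: "lam \<ge> (0.78::real)"
  shows "odd_euler q - 1 / 2 + real q powr - (3 / 2 * lam) < real q powr (lam / 2)"
proof -
  have q2: "2 \<le> q" using prime_ge_2_nat[OF q] .
  have "real q powr - (3 / 2 * lam) \<le> real q powr - 1"
    using q2 lam by (intro powr_mono) auto
  then have inv: "real q powr - (3 / 2 * lam) \<le> 1 / real q"
    using q2 by (simp add: powr_minus_divide)
  consider "q = 2" | "q = 3" | "q = 5" | "q = 7" | "11 \<le> q"
  proof -
    have "q = 2 \<or> q = 3 \<or> q = 5 \<or> q = 7 \<or> 11 \<le> q"
    proof (cases "3 < q")
      case True
      then obtain j where j: "q = 6 * j + 1 \<or> q = 6 * j + 5" using prime_mod_6[OF q] by auto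
      have "j = 0 \<or> j = 1 \<or> 2 \<le> j" by linarith
      then show ?thesis using j True by auto
    next
      case False
      then show ?thesis using q2 by auto
    qed
    then show ?thesis using that by blast
  qed
  then show ?thesis
  proof cases
    case 1
    \<comment> \<open>In each of the four small cases the constant on the left is the bound for
      \<open>odd_euler q\<close>, minus 1/2, plus 1/q; its cube is below q.\<close>
    have "1 < real q powr (lam / 2)" using 1 lam by (intro less_powr_third) auto
    then show ?thesis using inv odd_euler_2 1 by simp
  next
    case 2
    have "4 / 3 < real q powr (lam / 2)" using 2 lam by (intro less_powr_third) (auto simp: power_divide)
    then show ?thesis using inv odd_euler_3 2 by simp
  next
    case 3
    have "63 / 40 < real q powr (lam / 2)" using 3 lam by (intro less_powr_third) (auto simp: power_divide)
    then show ?thesis using inv odd_euler_5 3 by simp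
  next
    case 4
    have "205 / 112 < real q powr (lam / 2)" using 4 lam by (intro less_powr_third) (auto simp: power_divide)
    then show ?thesis using inv odd_euler_7 4 by simp
  next
    case 5
    \<comment> \<open>Here 39/100 = 0.78/2 and 17/100 = 3 * 39/100 - 1: the factor 3/2 of the cube
      bound has to be absorbed by q^(17/100), which works from 11 on.\<close>
    have "(3 / 2 :: real) ^ 100 \<le> 11 ^ 17" by (simp add: power_divide)
    also have "(11::real) ^ 17 \<le> real q ^ 17" using 5 by (intro power_mono) auto
    also have "\<dots> = (real q powr (17 / 100)) ^ 100" using 5 by (simp add: powr_power)
    finally have "3 / 2 \<le> real q powr (17 / 100)"
      by (subst (asm) power_mono_iff) auto
    then have "3 / 2 * real q \<le> real q powr (17 / 100) * real q powr 1" using 5 by (intro mult_mono) auto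
    also have "\<dots> = (real q powr (39 / 100)) ^ 3"
      using 5 by (subst powr_add[symmetric]) (simp add: powr_power)
    finally have "odd_euler q ^ 3 \<le> (real q powr (39 / 100)) ^ 3"
      using odd_euler_cube[OF q] 5 by linarith
    then have "odd_euler q \<le> real q powr (39 / 100)"
      using odd_euler_nonneg by (subst (asm) power_mono_iff) auto
    also have "\<dots> \<le> real q powr (lam / 2)" using 5 lam by (intro powr_mono) auto
    finally have "odd_euler q \<le> real q powr (lam / 2)" .
    moreover have "1 / real q < 1 / 2" using 5 by (simp add: field_simps)
    ultimately show ?thesis using inv by linarith
  qed
qed

section \<open>Balanced coprime factorizations\<close>

definition private_divisor :: "nat set \<Rightarrow> nat \<Rightarrow> nat \<Rightarrow> bool" where
  "private_divisor T d t \<longleftrightarrow> d dvd t \<and> (\<forall>s\<in>T. d dvd s \<longrightarrow> s = t)"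

lemma power_powr_eq: "0 < x \<Longrightarrow> (x ^ n) powr a = x powr (real n * a)" for x :: real
  by (simp add: powr_powr flip: powr_realpow)

lemma exists_balanced_coprime_factorization:
  fixes t :: nat
  assumes "0 < t" and pp: "\<And>p. prime p \<Longrightarrow> p dvd t \<Longrightarrow> (p ^ multiplicity p t) ^ 3 \<le> t ^ 2"
  obtains u v where "t = u * v" "coprime u v" "u ^ 3 \<le> t ^ 2" "v ^ 3 \<le> t ^ 2"
proof -
  \<comment> \<open>If the largest admissible unitary divisor \<open>u\<close> leaves too large a cofactor, then \<open>u < t\<^bsup>1/3\<^esup>\<close>, and
    any prime power of the cofactor that overshoots \<open>t\<^bsup>2/3\<^esup>\<close> together with \<open>u\<close> exceeds \<open>t\<^bsup>1/3\<^esup>\<close>, so it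
    can serve as one of the factors.\<close>
  define S where "S = {u. u dvd t \<and> coprime u (t div u) \<and> u ^ 3 \<le> t ^ 2}"
  have "finite S" using assms(1) by (simp add: S_def)
  have "1 \<in> S" using assms(1) by (simp add: S_def)
  define u where "u = Max S"
  have uS: "u \<in> S" unfolding u_def using \<open>finite S\<close> \<open>1 \<in> S\<close> by (intro Max_in) auto
  have umax: "w \<le> u" if "w \<in> S" for w unfolding u_def using \<open>finite S\<close> that by simp
  define v where "v = t div u"
  have t: "t = u * v" and cop: "coprime u v" and u3: "u ^ 3 \<le> t ^ 2"
    using uS by (auto simp: S_def v_def)
  have u0: "0 < u" "0 < v" using t assms(1) by auto
  show ?thesis
  proof (cases "v ^ 3 \<le> t ^ 2")
    case True
    then show ?thesis using that t cop u3 by blast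
  next
    case False
    then have v3: "t ^ 2 < v ^ 3" by simp
    have "v \<noteq> 1" using v3 assms(1) by auto
    then obtain p where p: "prime p" "p dvd v" using prime_factor_nat by blast
    define P where "P = p ^ multiplicity p v"
    define y where "y = v div P"
    have vy: "v = P * y" unfolding y_def P_def by (simp add: multiplicity_dvd)
    have "\<not> p dvd y" unfolding y_def P_def
      using u0 p by (intro multiplicity_decompose) (auto simp: prime_nat_iff)
    have "\<not> p dvd u" using cop p by (meson coprime_common_divisor not_prime_unit)
    have cP: "coprime P u" "coprime P y"
      using \<open>\<not> p dvd y\<close> \<open>\<not> p dvd u\<close> p unfolding P_def
      by (auto intro!: coprime_power_left_iff[THEN iffD2] simp: prime_imp_coprime)
    have "multiplicity p t = multiplicity p v"
      using t \<open>\<not> p dvd u\<close> p(1) u0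
      by (simp add: prime_elem_multiplicity_mult_distrib not_dvd_imp_multiplicity_0)
    then have P3: "P ^ 3 \<le> t ^ 2" using pp[OF p(1)] p(2) t by (simp add: P_def)
    have P1: "1 < P" unfolding P_def
      using p u0 prime_gt_1_nat[OF p(1)]
      by (intro one_less_power) (auto simp: prime_multiplicity_gt_zero_iff)
    have "u * P \<notin> S"
      using umax[of "u * P"] P1 u0 by auto
    moreover have "coprime (u * P) (t div (u * P))"
    proof -
      have "t div (u * P) = y" using t vy u0 P1 by (simp add: mult.assoc[symmetric])
      moreover have "coprime u y" using cop vy by simp
      ultimately show ?thesis using cP by simp
    qed
    moreover have "u * P dvd t" using t vy by simp
    ultimately have big: "t ^ 2 < (u * P) ^ 3" by (auto simp: S_def)
    have "(u * y) ^ 3 \<le> t ^ 2"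
    proof (rule ccontr)
      \<comment> \<open>As t = u P y, the two cubes multiply to u^3 t^3, which forces t < u^3; but
        v^3 > t^2 with t = u v forces u^3 < t.\<close>
      assume "\<not> ?thesis"
      then have "t ^ 2 < (u * y) ^ 3" by simp
      then have "t ^ 2 * t ^ 2 < (u * P) ^ 3 * (u * y) ^ 3"
        using big u0 P1 by (intro mult_strict_mono) auto
      also have "\<dots> = u ^ 3 * t ^ 3" by (simp add: t vy power_mult_distrib)
      finally have "t ^ 3 * t < t ^ 3 * u ^ 3" by (simp add: power_numeral_reduce mult_ac)
      then have "t < u ^ 3" by simp
      moreover have "t ^ 2 * u ^ 3 < v ^ 3 * u ^ 3" using v3 u0 by simp
      then have "t ^ 2 * u ^ 3 < t ^ 2 * t" by (simp add: t power_mult_distrib power_numeral_reduce mult_ac)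
      then have "u ^ 3 < t" by simp
      ultimately show False by simp
    qed
    moreover have "coprime P (u * y)" using cP by simp
    moreover have "t = P * (u * y)" using t vy by simp
    ultimately show ?thesis using that P3 by blast
  qed
qed

section \<open>Private divisors in a 2-primitive set\<close>

locale heavy_two_primitive =
  fixes T :: "nat set" and lam :: real
  assumes lam: "3 / 4 \<le> lam"
    and two_prim: "two_primitive T"
    and comp: "\<forall>t\<in>T. composite t"
    and heavy: "\<forall>p\<in>primes_of T. (\<Sum>\<^sub>\<infinity>t\<in>multiples_in T p. 1 / real t powr lam) > 1 / real p powr lam"
begin

lemma not_dvd_mult:
  "a \<in> T \<Longrightarrow> b \<in> T \<Longrightarrow> c \<in> T \<Longrightarrow> b \<noteq> a \<Longrightarrow> c \<noteq> a \<Longrightarrow> b \<noteq> c \<Longrightarrow> \<not> a dvd b * c"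
  using two_prim unfolding two_primitive_def by metis

lemma exists_third:
  obtains s where "s \<in> T" "s \<noteq> a" "s \<noteq> b"
proof -
  have "\<not> T \<subseteq> {a, b}"
  proof
    assume sub: "T \<subseteq> {a, b}"
    then have "finite T" using finite_subset by blast
    moreover have "card T \<le> card {a, b}" using sub by (intro card_mono) auto
    moreover have "card {a, b} \<le> 2" by (simp add: card_insert_if)
    ultimately show False using two_prim unfolding two_primitive_def by auto
  qed
  then show ?thesis using that by auto
qed

text \<open>A third element s turns a dvd b into a dvd b s, which 2-primitivity forbids.\<close>

lemma not_dvd:
  assumes "a \<in> T" "b \<in> T" "b \<noteq> a" shows "\<not> a dvd b"
proof -
  obtain s where "s \<in> T" "s \<noteq> a" "s \<noteq> b" by (rule exists_third)
  then show ?thesis using not_dvd_mult[of a b s] assms by (metis dvd_mult2)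
qed

lemma not_private_one: "t \<in> T \<Longrightarrow> \<not> private_divisor T 1 t"
  unfolding private_divisor_def by (metis exists_third one_dvd)

text \<open>Otherwise the factors have multiples b and c in \<open>T\<close> other than t. If b and
  c differ, t divides b c; if they coincide, coprimality makes t divide b.\<close>

lemma private_coprime_factor:
  assumes t: "t \<in> T" "t = u * v" and "coprime u v"
  shows "private_divisor T u t \<or> private_divisor T v t"
proof (rule ccontr)
  assume "\<not> ?thesis"
  then obtain b c where b: "b \<in> T" "u dvd b" "b \<noteq> t" and c: "c \<in> T" "v dvd c" "c \<noteq> t"
    unfolding private_divisor_def using t by auto
  show False
  proof (cases "b = c")
    case True
    then have "t dvd b" using b c t assms(3) by (simp add: divides_mult)
    then show False using not_dvd t b by blast
  next
    case False
    then show False using not_dvd_mult[of t b c] t b c by (metis mult_dvd_mono)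
  qed
qed

text \<open>The heaviness hypothesis rescaled by p^lam. It is strong when p has only one or two
  multiples in \<open>T\<close>, because the cofactors are at least 2.\<close>

lemma prime_weight_gt:
  assumes "prime p" "t \<in> T" "p dvd t" "finite (multiples_in T p)"
  shows "1 < (\<Sum>s\<in>multiples_in T p. real (s div p) powr - lam)"
proof -
  have p0: "0 < real p" using prime_gt_0_nat[OF assms(1)] by simp
  have "p \<in> primes_of T" using assms by (auto simp: primes_of_def)
  then have "1 / real p powr lam < (\<Sum>s\<in>multiples_in T p. 1 / real s powr lam)"
    using heavy assms(4) by force
  also have "\<dots> = (\<Sum>s\<in>multiples_in T p. real p powr - lam * real (s div p) powr - lam)"
  proof (rule sum.cong[OF refl])
    fix s assume "s \<in> multiples_in T p"
    then have "s = p * (s div p)" by (simp add: multiples_in_def)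
    then have "real s = real p * real (s div p)" by (metis of_nat_mult)
    then show "1 / real s powr lam = real p powr - lam * real (s div p) powr - lam"
      by (simp add: powr_mult powr_minus_divide)
  qed
  also have "\<dots> = real p powr - lam * (\<Sum>s\<in>multiples_in T p. real (s div p) powr - lam)"
    by (simp add: sum_distrib_left)
  finally have "real p powr - lam * 1 < real p powr - lam * (\<Sum>s\<in>multiples_in T p. real (s div p) powr - lam)"
    by (simp add: powr_minus_divide)
  then show ?thesis using p0 by (subst (asm) mult_less_cancel_left_pos) auto
qed

lemma cofactor_ge_2:
  assumes "t \<in> T" "prime p" "p dvd t" shows "2 \<le> t div p"
proof -
  have "t = p * (t div p)" using assms by simp
  moreover have "composite t" using comp assms by blast
  ultimately have "t div p \<noteq> 0" "t div p \<noteq> 1"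
    using assms(2) unfolding composite_def by (metis mult_0_right not_one_less_zero, metis mult.right_neutral)
  then show ?thesis by simp
qed

lemma not_private_prime:
  assumes "t \<in> T" "prime p" shows "\<not> private_divisor T p t"
proof
  assume pr: "private_divisor T p t"
  then have eq: "multiples_in T p = {t}"
    using assms(1) unfolding private_divisor_def multiples_in_def by blast
  have pt: "p dvd t" using pr by (simp add: private_divisor_def)
  have "1 < real (t div p) powr - lam"
    using prime_weight_gt[OF assms(2,1) pt] eq by simp
  moreover have "real (t div p) powr - lam \<le> real (t div p) powr 0"
    using cofactor_ge_2[OF assms pt] lam by (intro powr_mono) auto
  ultimately show False using cofactor_ge_2[OF assms pt] by simp
qed

text \<open>Two distinct cofactors whose weights exceed 1 in total must be 2 and 3. As p^2 divides
  t, p is the cofactor of t, so b is a product of two distinct primes, one of which would be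
  private.\<close>

lemma multiples_ne_pair:
  assumes t: "t \<in> T" and b: "b \<in> T" "b \<noteq> t" and p: "prime p" "p ^ 2 dvd t"
  shows "multiples_in T p \<noteq> {t, b}"
proof
  assume eq: "multiples_in T p = {t, b}"
  then have pd: "p dvd t" "p dvd b" by (auto simp: multiples_in_def)
  define m n where "m = t div p" and "n = b div p"
  have tm: "t = p * m" "b = p * n" using pd by (auto simp: m_def n_def)
  have mn: "2 \<le> m" "2 \<le> n" "m \<noteq> n"
    using cofactor_ge_2 t b p(1) pd tm unfolding m_def n_def by auto
  have sum: "1 < real m powr - lam + real n powr - lam"
    using prime_weight_gt[OF p(1) t pd(1)] eq b by (simp add: m_def n_def)
  \<comment> \<open>The exponent 3/4 makes the fourth power rational: 1/8 <= 81/625. Since 3/5 +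
    9/25 < 1, a cofactor of 4 or more is excluded below.\<close>
  have w2: "(2::real) powr - lam \<le> 3 / 5"
  proof -
    have "(2::real) powr - lam \<le> 2 powr - (3 / 4)" using lam by (intro powr_mono) auto
    also have "((2::real) powr - (3 / 4)) ^ 4 \<le> (3 / 5) ^ 4"
      by (simp add: powr_power power_divide powr_minus_divide)
    then have "(2::real) powr - (3 / 4) \<le> 3 / 5" by (subst (asm) power_mono_iff) auto
    finally show ?thesis .
  qed
  have w3: "(3::real) powr - lam \<le> 1 / 2"
  proof -
    have "(3::real) powr - lam \<le> 3 powr - (3 / 4)" using lam by (intro powr_mono) auto
    also have "((3::real) powr - (3 / 4)) ^ 4 \<le> (1 / 2) ^ 4"
      by (simp add: powr_power power_divide powr_minus_divide)
    then have "(3::real) powr - (3 / 4) \<le> 1 / 2" by (subst (asm) power_mono_iff) auto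
    finally show ?thesis .
  qed
  have w4: "(4::real) powr - lam \<le> 9 / 25"
  proof -
    have "(4::real) powr - lam = (2 powr - lam) * (2 powr - lam)"
      by (simp flip: powr_mult)
    also have "\<dots> \<le> (3 / 5) * (3 / 5)" using w2 by (intro mult_mono) auto
    finally show ?thesis by simp
  qed
  have anti: "real x powr - lam \<le> real y powr - lam" if "0 < y" "y \<le> x" for x y :: nat
    using that lam by (intro powr_mono2') auto
  have w2': "real x powr - lam \<le> 3 / 5" if "2 \<le> x" for x
    using anti[of 2 x] that w2 by simp
  have w3': "real x powr - lam \<le> 1 / 2" if "3 \<le> x" for x
    using anti[of 3 x] that w3 by simp
  have w4': "real x powr - lam \<le> 9 / 25" if "4 \<le> x" for x
    using anti[of 4 x] that w4 by simp
  have "m < 4" using w4'[of m] w2'[of n] mn sum by (cases "m < 4") auto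
  moreover have "n < 4" using w4'[of n] w2'[of m] mn sum by (cases "n < 4") auto
  ultimately have cases: "(m = 2 \<and> n = 3) \<or> (m = 3 \<and> n = 2)" using mn by auto
  have "p dvd m" using p(2) tm(1) prime_gt_0_nat[OF p(1)] by (simp add: power2_eq_square)
  have pm: "prime m" "prime n" using cases by auto
  then have "p = m" using \<open>p dvd m\<close> p(1) primes_dvd_imp_eq by blast
  have "coprime p n" using cases \<open>p = m\<close> by auto
  then show False
    using private_coprime_factor[of b p n] not_private_prime b tm p(1) pm by blast
qed

text \<open>If no prime power component exceeds t^(2/3), a balanced factorization applies. Otherwise
  t = p^a y with y^2 < p^a, and y or p^a is private. A private y is small; for a private p^a, a = 1
  is impossible, a >= 3 is the second alternative, and for a = 2 the divisor p y is private and
  small.\<close>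

lemma exists_small_private_divisor:
  assumes t: "t \<in> T"
  shows "(\<exists>d. private_divisor T d t \<and> d ^ 3 \<le> t ^ 2) \<or>
    (\<exists>p a. prime p \<and> 3 \<le> a \<and> private_divisor T (p ^ a) t)"
proof (cases "\<forall>p. prime p \<longrightarrow> p dvd t \<longrightarrow> (p ^ multiplicity p t) ^ 3 \<le> t ^ 2")
  case True
  have "0 < t" using comp t by (auto simp: composite_def)
  then obtain u v where "t = u * v" "coprime u v" "u ^ 3 \<le> t ^ 2" "v ^ 3 \<le> t ^ 2"
    using exists_balanced_coprime_factorization True by metis
  then show ?thesis using private_coprime_factor[OF t] by metis
next
  case False
  then obtain p where p: "prime p" "p dvd t" and big: "t ^ 2 < (p ^ multiplicity p t) ^ 3"
    by auto
  have t0: "0 < t" using comp t by (auto simp: composite_def)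
  define a where "a = multiplicity p t"
  define y where "y = t div p ^ a"
  have ty: "t = p ^ a * y" by (simp add: y_def a_def multiplicity_dvd)
  have y0: "0 < y" using ty t0 by auto
  have py: "\<not> p dvd y" unfolding y_def a_def
    using t0 p by (intro multiplicity_decompose) (auto simp: prime_nat_iff)
  have p0: "0 < p" using prime_gt_0_nat[OF p(1)] .
  have a1: "1 \<le> a" using p t0 by (simp add: a_def Suc_le_eq prime_multiplicity_gt_zero_iff)
  have cop: "coprime (p ^ a) y" using py p by (simp add: prime_imp_coprime)
  have "(p ^ a) ^ 2 * y ^ 2 < (p ^ a) ^ 2 * p ^ a"
    using big unfolding a_def[symmetric] by (simp add: ty power_mult_distrib power_numeral_reduce mult_ac)
  then have ya: "y ^ 2 < p ^ a" by simp
  show ?thesis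
  proof (cases "private_divisor T y t")
    case True
    have "y ^ 2 * y \<le> p ^ a * (p ^ a * y ^ 2)"
    proof (intro mult_mono)
      have "1 * y ^ 1 \<le> p ^ a * y ^ 2"
        using y0 p0 by (intro mult_mono power_increasing) auto
      then show "y \<le> p ^ a * y ^ 2" by simp
    qed (use ya in auto)
    then have "y ^ 3 \<le> t ^ 2" by (simp add: ty power_mult_distrib power_numeral_reduce mult_ac)
    then show ?thesis using True by blast
  next
    case False
    then have pa: "private_divisor T (p ^ a) t" using private_coprime_factor[OF t ty cop] by blast
    then have "a \<noteq> 1" using not_private_prime[OF t p(1)] by auto
    show ?thesis
    proof (cases "3 \<le> a")
      case True
      then show ?thesis using pa p by blast
    next
      case False
      \<comment> \<open>The factors \<open>p y\<close> and \<open>p\<close> are not coprime; three multiples of \<open>p\<close> in \<open>T\<close> make up for it.\<close>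
      then have a2: "a = 2" using a1 \<open>a \<noteq> 1\<close> by auto
      have "private_divisor T (p * y) t"
      proof (rule ccontr)
        assume "\<not> ?thesis"
        moreover have "p * y dvd t" using ty a2 by (simp add: power2_eq_square)
        ultimately obtain b where b: "b \<in> T" "b \<noteq> t" "p * y dvd b"
          unfolding private_divisor_def by blast
        have "p ^ 2 dvd t" using ty a2 by simp
        then have "multiples_in T p \<noteq> {t, b}" using multiples_ne_pair t b p by blast
        moreover have "{t, b} \<subseteq> multiples_in T p"
          using t b p by (auto simp: multiples_in_def dest: dvd_mult_left)
        ultimately obtain c where c: "c \<in> T" "p dvd c" "c \<noteq> t" "c \<noteq> b"
          unfolding multiples_in_def by auto
        have "t = (p * y) * p" using ty a2 by (simp add: power2_eq_square)
        then have "t dvd b * c" using b c by (metis mult_dvd_mono)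
        then show False using not_dvd_mult t b c by metis
      qed
      moreover have "(p * y) ^ 3 \<le> t ^ 2"
      proof -
        have "y \<le> p" using ya a2 power2_less_imp_less[of y p] by simp
        then have "p ^ 3 * y ^ 2 * y \<le> p ^ 3 * y ^ 2 * p" by simp
        then show ?thesis by (simp add: ty a2 power_mult_distrib power_numeral_reduce mult_ac)
      qed
      ultimately show ?thesis by blast
    qed
  qed
qed

section \<open>Charging elements to primes\<close>

text \<open>The bound does not depend on \<open>F\<close>, so it yields summability over
  \<open>T\<close> as well as a bound for the infinite sum.\<close>

lemma sum_finite_subset_le:
  assumes F: "finite F" "F \<subseteq> T" and fin: "finite (primes_of T)"
  shows "(\<Sum>t\<in>F. real t powr - lam) \<le>
    (\<Sum>q\<in>primes_of T. real q powr - (3 / 2 * lam) * (odd_euler q - 1 / 2) + real q powr - (3 * lam))"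
proof -
  define A where "A = {t \<in> F. \<exists>d. private_divisor T d t \<and> d ^ 3 \<le> t ^ 2}"
  define B where "B = F - A"
  have "\<forall>t\<in>A. \<exists>d. private_divisor T d t \<and> d ^ 3 \<le> t ^ 2" by (simp add: A_def)
  then obtain f where f: "\<And>t. t \<in> A \<Longrightarrow> private_divisor T (f t) t \<and> f t ^ 3 \<le> t ^ 2" by metis
  have "\<forall>t\<in>B. \<exists>p a. prime p \<and> 3 \<le> a \<and> private_divisor T (p ^ a) t"
    using exists_small_private_divisor F(2) by (auto simp: A_def B_def)
  then obtain g e where g: "\<And>t. t \<in> B \<Longrightarrow> prime (g t) \<and> 3 \<le> e t \<and> private_divisor T (g t ^ e t) t"
    by metis
  have AT: "t \<in> T" if "t \<in> A" for t using that F(2) by (auto simp: A_def)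
  have BT: "t \<in> T" if "t \<in> B" for t using that F(2) by (auto simp: B_def)
  have finA: "finite A" and finB: "finite B" using F(1) by (auto simp: A_def B_def)
  have pos: "0 < t" if "t \<in> T" for t using comp that by (auto simp: composite_def)
  have fpos: "0 < f t" if "t \<in> A" for t
    using f[OF that] pos[OF AT[OF that]] dvd_pos_nat[of t "f t"]
    unfolding private_divisor_def by blast
  have fcomp: "composite (f t)" if "t \<in> A" for t
  proof -
    have "f t \<noteq> 1" "\<not> prime (f t)"
      using f[OF that] not_private_one not_private_prime AT[OF that] by metis+
    then show ?thesis using fpos[OF that] by (auto simp: composite_def)
  qed
  \<comment> \<open>If f t divides f s it divides s, and privacy forces s = t. This gives both the
    antichain property and injectivity.\<close>
  have fanti: "t = s" if "t \<in> A" "s \<in> A" "f t dvd f s" for t s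
    using that f AT unfolding private_divisor_def by (metis dvd_trans)
  have injf: "inj_on f A" using fanti by (auto intro!: inj_onI)
  \<comment> \<open>Of two powers of one prime, one divides the other, so each prime serves at most
    one exceptional element.\<close>
  have injg: "inj_on g B"
  proof (rule inj_onI)
    fix t s assume ts: "t \<in> B" "s \<in> B" "g t = g s"
    show "t = s"
    proof (cases "e t \<le> e s")
      case True
      then have "g t ^ e t dvd g s ^ e s" using ts by (simp add: le_imp_power_dvd)
      then show ?thesis using g ts BT unfolding private_divisor_def by (metis dvd_trans)
    next
      case False
      then have "g s ^ e s dvd g t ^ e t" using ts by (simp add: le_imp_power_dvd)
      then show ?thesis using g ts BT unfolding private_divisor_def by (metis dvd_trans)
    qed
  qed
  define h where "h d = Max (prime_factors d)" for d :: nat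
  have h: "prime (h d)" "h d dvd d" "\<And>p. prime p \<Longrightarrow> p dvd d \<Longrightarrow> p \<le> h d" if "composite d" for d
  proof -
    have d: "1 < d" using that by (simp add: composite_def)
    then have "prime_factors d \<noteq> {}" by (simp add: prime_factorization_empty_iff)
    then have "h d \<in> prime_factors d" unfolding h_def by (intro Max_in) auto
    then show "prime (h d)" "h d dvd d" by auto
    show "p \<le> h d" if "prime p" "p dvd d" for p
      unfolding h_def using that d by (intro Max_ge) (auto simp: prime_factors_dvd)
  qed
  have hmem: "h d \<in> primes_of T" if d: "d \<in> f ` A" for d
  proof -
    obtain t where t: "t \<in> A" "d = f t" using d by blast
    then have "h d dvd t" using h(2)[OF fcomp] f[OF t(1)] unfolding private_divisor_def
      by (metis dvd_trans)
    then show ?thesis using h(1)[OF fcomp] t AT by (auto simp: primes_of_def)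
  qed
  have "(\<Sum>t\<in>A. real t powr - lam) \<le> (\<Sum>t\<in>A. real (f t) powr - (3 / 2 * lam))"
  proof (rule sum_mono)
    fix t assume t: "t \<in> A"
    have "real (f t ^ 3) \<le> real (t ^ 2)" using f[OF t] by (simp only: of_nat_le_iff)
    then have "real (t ^ 2) powr - (lam / 2) \<le> real (f t ^ 3) powr - (lam / 2)"
      using lam fpos[OF t] by (intro powr_mono2') auto
    then show "real t powr - lam \<le> real (f t) powr - (3 / 2 * lam)"
      using fpos[OF t] pos[OF AT[OF t]] by (simp add: power_powr_eq)
  qed
  also have "\<dots> = (\<Sum>d\<in>f ` A. real d powr - (3 / 2 * lam))"
    by (simp add: sum.reindex[OF injf])
  also have "\<dots> = (\<Sum>q\<in>primes_of T. \<Sum>d | d \<in> f ` A \<and> h d = q. real d powr - (3 / 2 * lam))"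
    using finA fin hmem by (intro sum.group[symmetric]) auto
  also have "\<dots> \<le> (\<Sum>q\<in>primes_of T. real q powr - (3 / 2 * lam) * (odd_euler q - 1 / 2))"
  proof (rule sum_mono, rule sum_powr_antichain_le)
    fix q assume "q \<in> primes_of T"
    then show "prime q" by (simp add: primes_of_def)
    show "finite {d \<in> f ` A. h d = q}" using finA by simp
    show "1 \<le> 3 / 2 * lam" using lam by simp
    show "composite d" if "d \<in> {d \<in> f ` A. h d = q}" for d using that fcomp by auto
    then show "q dvd d" if "d \<in> {d \<in> f ` A. h d = q}" for d using that h(2) by blast
    show "p \<le> q" if "d \<in> {d \<in> f ` A. h d = q}" "prime p" "p dvd d" for d p
      using that h(3) fcomp by blast
    show "d = d'" if "d \<in> {d \<in> f ` A. h d = q}" "d' \<in> {d \<in> f ` A. h d = q}" "d dvd d'" for d d'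
      using that fanti by auto
  qed
  finally have A_le: "(\<Sum>t\<in>A. real t powr - lam)
    \<le> (\<Sum>q\<in>primes_of T. real q powr - (3 / 2 * lam) * (odd_euler q - 1 / 2))" .
  have "(\<Sum>t\<in>B. real t powr - lam) \<le> (\<Sum>t\<in>B. real (g t) powr - (3 * lam))"
  proof (rule sum_mono)
    fix t assume t: "t \<in> B"
    have g0: "0 < g t" using g[OF t] prime_gt_0_nat by blast
    have "g t ^ 3 \<le> g t ^ e t" using g[OF t] g0 by (intro power_increasing) auto
    also have "\<dots> \<le> t" using g[OF t] pos[OF BT[OF t]] by (auto simp: private_divisor_def intro: dvd_imp_le)
    finally have "real (g t ^ 3) \<le> real t" by (simp only: of_nat_le_iff)
    then have "real t powr - lam \<le> real (g t ^ 3) powr - lam"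
      using lam g0 by (intro powr_mono2') auto
    then show "real t powr - lam \<le> real (g t) powr - (3 * lam)"
      using g0 by (simp add: power_powr_eq)
  qed
  also have "\<dots> = (\<Sum>q\<in>g ` B. real q powr - (3 * lam))"
    by (simp add: sum.reindex[OF injg])
  also have "\<dots> \<le> (\<Sum>q\<in>primes_of T. real q powr - (3 * lam))"
  proof (rule sum_mono2[OF fin])
    show "g ` B \<subseteq> primes_of T"
    proof
      fix q assume "q \<in> g ` B"
      then obtain t where t: "t \<in> B" "q = g t" by blast
      have "q dvd q ^ e t" using g[OF t(1)] by (intro dvd_power) auto
      then have "q dvd t" using g[OF t(1)] t(2) unfolding private_divisor_def by (metis dvd_trans)
      then show "q \<in> primes_of T" using g[OF t(1)] t BT by (auto simp: primes_of_def)
    qed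
  qed simp
  finally have B_le: "(\<Sum>t\<in>B. real t powr - lam) \<le> (\<Sum>q\<in>primes_of T. real q powr - (3 * lam))" .
  have "(\<Sum>t\<in>F. real t powr - lam) = (\<Sum>t\<in>A. real t powr - lam) + (\<Sum>t\<in>B. real t powr - lam)"
    using sum.subset_diff[of A F "\<lambda>t. real t powr - lam"] F(1) by (simp add: A_def B_def add.commute)
  then show ?thesis using A_le B_le by (simp add: sum.distrib)
qed

end

section \<open>Passage to the infinite sum\<close>

theorem theorem3p2:
  fixes lam Y :: real and T :: "nat set"
  assumes "lam \<ge> 0.7983"
    and "Y \<ge> 2"
    and "two_primitive T"
    and "\<forall>t\<in>T. composite t"
    and "\<forall>p\<in>primes_of T. (\<Sum>\<^sub>\<infinity>t\<in>multiples_in T p. 1 / real t powr lam) > 1 / real p powr lam"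
    and "primes_of T = {p. prime p \<and> real p \<le> Y}"
  shows "(\<Sum>\<^sub>\<infinity>t\<in>T. 1 / real t powr lam) - (\<Sum>p | prime p \<and> real p \<le> Y. 1 / real p powr lam) < 0"
proof -
  have "3 / 4 \<le> lam" using assms(1) by simp
  then interpret heavy_two_primitive T lam
    using assms(3-5) by unfold_locales
  have fin: "finite (primes_of T)"
    unfolding assms(6) by (rule finite_subset[of _ "{..nat \<lfloor>Y\<rfloor>}"]) (auto simp: le_nat_floor)
  define C where "C = (\<Sum>q\<in>primes_of T.
    real q powr - (3 / 2 * lam) * (odd_euler q - 1 / 2) + real q powr - (3 * lam))"
  have bound: "(\<Sum>t\<in>F. 1 / real t powr lam) \<le> C" if "finite F" "F \<subseteq> T" for F
    using sum_finite_subset_le[OF that fin] by (simp add: C_def powr_minus_divide)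
  \<comment> \<open>Summability ensures that the infinite sum is a genuine limit of partial sums
    rather than the default value 0.\<close>
  have "(\<lambda>t. 1 / real t powr lam) summable_on T"
    using bound by (intro nonneg_bdd_above_summable_on bdd_aboveI) auto
  then have "(\<Sum>\<^sub>\<infinity>t\<in>T. 1 / real t powr lam) \<le> C"
    using bound by (intro infsum_le_finite_sums)
  also have "C < (\<Sum>q\<in>primes_of T. 1 / real q powr lam)"
    unfolding C_def
  proof (rule sum_strict_mono[OF fin])
    \<comment> \<open>Termwise strictness survives summation only over a nonempty set; Y >= 2
      supplies the prime 2.\<close>
    have "2 \<in> primes_of T" using assms(2,6) by simp
    then show "primes_of T \<noteq> {}" by blast
    fix q assume "q \<in> primes_of T"
    then have q: "prime q" by (simp add: primes_of_def)
    have q0: "0 < real q" using prime_gt_0_nat[OF q] by simp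
    have "real q powr - (3 / 2 * lam) * (odd_euler q - 1 / 2 + real q powr - (3 / 2 * lam))
        < real q powr - (3 / 2 * lam) * real q powr (lam / 2)"
      using odd_euler_less_powr[OF q] assms(1) q0 by (intro mult_strict_left_mono) auto
    also have "\<dots> = 1 / real q powr lam"
      by (subst powr_add[symmetric]) (simp add: powr_minus_divide)
    finally show "real q powr - (3 / 2 * lam) * (odd_euler q - 1 / 2) + real q powr - (3 * lam)
        < 1 / real q powr lam"
      by (simp add: distrib_left flip: powr_add)
  qed
  finally show ?thesis by (simp add: assms(6))
qed

end
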